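(* Let $M$ be an $(s,t)$-rack, and $a\in M$. Then $$\overline{a}=\{\left(t^k+1-(1-s)^k\right)a : k\in\mathbb{Z},\ k\ge 0\}\cup \left\{\frac{(1-s)^k}{t^k}a : k\in\mathbb{Z},\ k\ge 0\right\}.$$ In particular, if $M$ is finite, then $$\overline{a}=\{\left(t^k+1-(1-s)^k\right)a : k\in\mathbb{Z},\ k\ge 0\}= \left\{\frac{(1-s)^k}{t^k}a : k\in\mathbb{Z},\ k\ge 0\right\}.$$
   Context: A rack is a set with a binary operation $\triangleright$ such that (i) $a\triangleright(b\triangleright c)=(a\triangleright b)\triangleright(a\triangleright c)$ for all $a,b,c$, and (ii) for all $a,b$ there is a unique $c$ with $a\triangleright c=b$. Let $A=\mathbb{Z}[t,t^{-1},s]/\langle s^2-s(1-t)\rangle$ (commutative polynomial ring with $t$ invertible), and write $s,t$ also for their images in $A$. An $(s,t)$-rack is an $A$-module $M$ with the operation $x\triangleright y=sx+ty$; it is a rack. A subset of a rack is a subrack if it is a rack under the same operation. For $a\in M$, $f_a$ is the bijection $f_a(b)=a\triangleright b$, and $\ll a\gg$ is the intersection of all subracks of $M$ containing $a$. $\overline{a}$ denotes the equivalence class of $a$ under the relation $a\sim b\iff \ll a\gg=\ll b\gg$; one has $\overline{a}=\ll a\gg=\{f_a^k(a):k\in\mathbb{Z}\}$. The notation $\frac{(1-s)^k}{t^k}$ means $(1-s)^k(t^{-1})^k$. *)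

theory Defs
  imports Complex_Main "HOL-Library.Poly_Mapping" "HOL-Library.Product_Plus"
begin

definition is_rack :: "'a set \<Rightarrow> ('a \<Rightarrow> 'a \<Rightarrow> 'a) \<Rightarrow> bool" where
  "is_rack R rop \<longleftrightarrow>
     (\<forall>a\<in>R. \<forall>b\<in>R. rop a b \<in> R) \<and>
     (\<forall>a\<in>R. \<forall>b\<in>R. \<forall>c\<in>R. rop a (rop b c) = rop (rop a b) (rop a c)) \<and>
     (\<forall>a\<in>R. \<forall>b\<in>R. \<exists>!c. c \<in> R \<and> rop a c = b)"

definition subrack :: "'a set \<Rightarrow> 'a set \<Rightarrow> ('a \<Rightarrow> 'a \<Rightarrow> 'a) \<Rightarrow> bool" where
  "subrack S R rop \<longleftrightarrow> S \<subseteq> R \<and> is_rack S rop"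

definition gen_subrack :: "'a set \<Rightarrow> ('a \<Rightarrow> 'a \<Rightarrow> 'a) \<Rightarrow> 'a \<Rightarrow> 'a set" where
  "gen_subrack R rop a = \<Inter> {S. subrack S R rop \<and> a \<in> S}"

definition gen_class :: "'a set \<Rightarrow> ('a \<Rightarrow> 'a \<Rightarrow> 'a) \<Rightarrow> 'a \<Rightarrow> 'a set" where
  "gen_class R rop a = {b \<in> R. gen_subrack R rop a = gen_subrack R rop b}"

text \<open>The ring of Laurent polynomials in \<open>t\<close> with a further polynomial variable \<open>s\<close>, over the
  integers, is the monoid ring of \<open>\<int> \<times> \<nat>\<close>: the key \<open>(i, j)\<close> stands for the monomial
  \<open>t\<^sup>i s\<^sup>j\<close>, and multiplication is convolution.\<close>

type_synonym laurent_st = "(int \<times> nat) \<Rightarrow>\<^sub>0 int"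

definition t_pre :: laurent_st where "t_pre = Poly_Mapping.single (1, 0) 1"
definition t_inv_pre :: laurent_st where "t_inv_pre = Poly_Mapping.single (- 1, 0) 1"
definition s_pre :: laurent_st where "s_pre = Poly_Mapping.single (0, 1) 1"

definition st_relator :: laurent_st where
  "st_relator = s_pre ^ 2 - s_pre * (1 - t_pre)"

text \<open>In a commutative ring, divisibility by \<open>st_relator\<close> is membership in the ideal it
  generates, so the quotient by \<open>st_cong\<close> is the quotient ring by the relation
  \<open>s\<^sup>2 = s (1 - t)\<close>.\<close>

definition st_cong :: "laurent_st \<Rightarrow> laurent_st \<Rightarrow> bool" where
  "st_cong p q \<longleftrightarrow> st_relator dvd (p - q)"

lemma st_relator_keys: "k \<in> Poly_Mapping.keys st_relator \<Longrightarrow> 1 \<le> snd k"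
proof -
  have e: "st_relator = Poly_Mapping.single (0, 2) 1 - Poly_Mapping.single (0, 1) 1
      + Poly_Mapping.single (1, 1) 1"
    unfolding st_relator_def s_pre_def t_pre_def power2_eq_square right_diff_distrib mult_single
    by (simp only: add_Pair mult_1_right mult_single) (simp add: numeral_2_eq_2)
  assume "k \<in> Poly_Mapping.keys st_relator"
  then show ?thesis
    by (auto simp: e in_keys_iff lookup_add lookup_minus lookup_single when_def split: if_splits)
qed

lemma not_st_cong_0_1: "\<not> st_cong 0 1"
proof
  assume "st_cong 0 1"
  then have "st_relator dvd 1"
    by (simp add: st_cong_def)
  then obtain p where p: "1 = st_relator * p"
    by (auto simp: dvd_def)
  have "(0 :: int \<times> nat) \<in> Poly_Mapping.keys (1 :: laurent_st)"
    by simp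
  then obtain a b where "a \<in> Poly_Mapping.keys st_relator" "0 = a + (b :: int \<times> nat)"
    using keys_mult[of st_relator p] unfolding p by auto
  with st_relator_keys[of a] show False
    by (cases a; cases b) (auto simp: zero_prod_def)
qed

lemma equivp_st_cong: "equivp st_cong"
proof (rule equivpI)
  show "reflp st_cong"
    by (simp add: reflp_def st_cong_def)
  show "symp st_cong"
  proof (rule sympI)
    fix p q assume "st_cong p q"
    then have "st_relator dvd - (p - q)"
      unfolding st_cong_def by (simp only: dvd_minus_iff)
    then show "st_cong q p"
      unfolding st_cong_def by (simp only: minus_diff_eq)
  qed
  show "transp st_cong"
  proof (rule transpI)
    fix p q r assume "st_cong p q" "st_cong q r"
    then have "st_relator dvd (p - q) + (q - r)"
      unfolding st_cong_def by (rule dvd_add)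
    then show "st_cong p r"
      unfolding st_cong_def by simp
  qed
qed

quotient_type st_ring = laurent_st / st_cong
  by (rule equivp_st_cong)

instantiation st_ring :: comm_ring_1
begin

lift_definition zero_st_ring :: st_ring is 0 .
lift_definition one_st_ring :: st_ring is 1 .

lift_definition plus_st_ring :: "st_ring \<Rightarrow> st_ring \<Rightarrow> st_ring" is "(+)"
proof -
  fix p p' q q' assume "st_cong p p'" "st_cong q q'"
  moreover have "p + q - (p' + q') = (p - p') + (q - q')"
    by simp
  ultimately show "st_cong (p + q) (p' + q')"
    unfolding st_cong_def by (simp only: dvd_add)
qed

lift_definition uminus_st_ring :: "st_ring \<Rightarrow> st_ring" is uminus
proof -
  fix p p' assume "st_cong p p'"
  moreover have "- p - (- p') = - (p - p')"
    by simp
  ultimately show "st_cong (- p) (- p')"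
    unfolding st_cong_def by (simp only: dvd_minus_iff)
qed

lift_definition minus_st_ring :: "st_ring \<Rightarrow> st_ring \<Rightarrow> st_ring" is "(-)"
proof -
  fix p p' q q' assume "st_cong p p'" "st_cong q q'"
  moreover have "p - q - (p' - q') = (p - p') - (q - q')"
    by simp
  ultimately show "st_cong (p - q) (p' - q')"
    unfolding st_cong_def by (simp only: dvd_diff)
qed

lift_definition times_st_ring :: "st_ring \<Rightarrow> st_ring \<Rightarrow> st_ring" is "(*)"
proof -
  fix p p' q q' assume "st_cong p p'" "st_cong q q'"
  moreover have "p * q - p' * q' = (p - p') * q + p' * (q - q')"
    by (simp add: algebra_simps)
  ultimately show "st_cong (p * q) (p' * q')"
    unfolding st_cong_def by (simp only: dvd_add dvd_mult dvd_mult2)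
qed

instance
proof
  fix a b c :: st_ring
  show "a * b * c = a * (b * c)"
    by transfer (simp add: st_cong_def mult.assoc)
  show "a * b = b * a"
    by transfer (simp add: st_cong_def mult.commute)
  show "1 * a = a"
    by transfer (simp add: st_cong_def)
  show "a + b + c = a + (b + c)"
    by transfer (simp add: st_cong_def add.assoc)
  show "a + b = b + a"
    by transfer (simp add: st_cong_def add.commute)
  show "0 + a = a"
    by transfer (simp add: st_cong_def)
  show "- a + a = 0"
    by transfer (simp add: st_cong_def)
  show "a - b = a + - b"
    by transfer (simp add: st_cong_def)
  show "(a + b) * c = a * c + b * c"
    by transfer (simp add: st_cong_def algebra_simps)
  show "(0 :: st_ring) \<noteq> 1"
    by transfer (rule not_st_cong_0_1)
qed

end

lift_definition t_st :: st_ring is t_pre .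
lift_definition t_inv_st :: st_ring is t_inv_pre .
lift_definition s_st :: st_ring is s_pre .

lemma t_st_inverse: "t_st * t_inv_st = 1"
  by transfer (simp add: st_cong_def t_pre_def t_inv_pre_def mult_single flip: single_one zero_prod_def)

lemma s_st_square: "s_st ^ 2 = s_st * (1 - t_st)"
  unfolding power2_eq_square
  by transfer (simp add: st_cong_def st_relator_def power2_eq_square)

definition st_rack_op :: "(st_ring \<Rightarrow> 'm \<Rightarrow> 'm) \<Rightarrow> 'm \<Rightarrow> 'm \<Rightarrow> 'm::ab_group_add" where
  "st_rack_op scale x y = scale s_st x + scale t_st y"

end

theory Submission
  imports Defs
begin

text \<open>
  The element \<open>u = s + t\<close> of the coefficient ring is a unit with inverse \<open>v = (1 - s) t\<^sup>-\<^sup>1\<close>,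
  because \<open>(s + t) (1 - s) = t\<close>, and it satisfies \<open>s u = s\<close>; both are restatements of
  \<open>s\<^sup>2 = s (1 - t)\<close>. Every power \<open>w\<close> of \<open>u\<close>, of either sign, therefore satisfies \<open>s w = s\<close>, so the
  left translation by \<open>w a\<close> is the left translation by \<open>a\<close>, and on the orbit of \<open>a\<close> under
  \<open>\<langle>u\<rangle>\<close> the rack operation is just \<open>x \<triangleright> y = u y\<close>. Hence this orbit is a subrack
  (\<open>is_rack_orbit\<close>), and it lies in every subrack containing \<open>a\<close>, since the translation by \<open>a\<close>
  and its inverse move along it (\<open>orbit_subset_rack\<close>). So \<open>\<lless>a\<ggreater>\<close> is the orbit of \<open>a\<close>, and as
  orbits of a group partition the module, the class of \<open>a\<close> is this same orbit.

  It remains to recognise the coefficients. The nonpositive powers of \<open>u\<close> are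
  \<open>(1 - s)\<^sup>k t\<^sup>-\<^sup>k\<close> by the formula for \<open>v\<close>; the nonnegative ones are
  \<open>t\<^sup>k + 1 - (1 - s)\<^sup>k\<close> by induction (\<open>u_power\<close>). If \<open>M\<close> is finite then some positive power of
  \<open>u\<close> fixes \<open>a\<close>, so nonnegative and nonpositive powers produce the same elements
  (\<open>inverse_powers_eq_powers\<close>).
\<close>

section \<open>The orbit of a unit acting on a module\<close>

text \<open>For a unit \<open>u\<close> with inverse \<open>v\<close>, the orbit under the cyclic group \<open>\<langle>u\<rangle>\<close>. Natural exponents on
  both generators stand in for integer exponents on \<open>u\<close>, and make \<open>u\<close> and \<open>v\<close> interchangeable.\<close>

locale unit_module = Modules.module scale
  for scale :: "'a::comm_ring_1 \<Rightarrow> 'b::ab_group_add \<Rightarrow> 'b" (infixr "*s" 75) +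
  fixes u v :: 'a
  assumes u_v: "u * v = 1"
begin

definition orbit :: "'b \<Rightarrow> 'b set" where
  "orbit x = range (\<lambda>k. (u ^ k) *s x) \<union> range (\<lambda>k. (v ^ k) *s x)"

lemma swap: "unit_module scale v u"
  by unfold_locales (simp add: u_v mult.commute)

lemma orbit_swap: "unit_module.orbit scale v u = orbit"
  by (intro ext) (auto simp: unit_module.orbit_def[OF swap] orbit_def)

lemma u_power_in_orbit: "(u ^ k) *s x \<in> orbit x"
  by (auto simp: orbit_def)

lemma v_power_in_orbit: "(v ^ k) *s x \<in> orbit x"
  by (auto simp: orbit_def)

lemma orbit_cases:
  assumes "y \<in> orbit x"
  obtains k where "y = (u ^ k) *s x" | k where "y = (v ^ k) *s x"
  using assms by (auto simp: orbit_def)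

lemma orbit_refl: "x \<in> orbit x"
  using u_power_in_orbit[of 0 x] by simp

lemma orbit_step:
  assumes "y \<in> orbit x"
  shows "u *s y \<in> orbit x"
  using assms
proof (cases rule: orbit_cases)
  case (1 k)
  then show ?thesis using u_power_in_orbit[of "Suc k" x] by simp
next
  case (2 k)
  show ?thesis
  proof (cases k)
    case 0
    with 2 show ?thesis using u_power_in_orbit[of 1 x] by simp
  next
    case (Suc j)
    with 2 have "u *s y = (u * v * v ^ j) *s x" by (simp add: mult.assoc)
    then show ?thesis using v_power_in_orbit by (simp add: u_v)
  qed
qed

lemma orbit_step_inverse:
  assumes "y \<in> orbit x"
  shows "v *s y \<in> orbit x"
  using unit_module.orbit_step[OF swap] assms by (simp add: orbit_swap)

lemma orbit_subset:
  assumes y: "y \<in> orbit x"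
  shows "orbit y \<subseteq> orbit x"
proof -
  have "(u ^ k) *s y \<in> orbit x" for k
  proof (induction k)
    case (Suc k)
    then show ?case using orbit_step[OF Suc] by simp
  qed (simp add: y)
  moreover have "(v ^ k) *s y \<in> orbit x" for k
  proof (induction k)
    case (Suc k)
    then show ?case using orbit_step_inverse[OF Suc] by simp
  qed (simp add: y)
  ultimately show ?thesis by (auto simp: orbit_def)
qed

lemma v_power_u_power: "(v ^ k) *s ((u ^ k) *s x) = x"
proof -
  have "v ^ k * u ^ k = 1" using u_v by (simp add: mult.commute flip: power_mult_distrib)
  then show ?thesis by simp
qed

lemma orbit_sym:
  assumes "y \<in> orbit x"
  shows "x \<in> orbit y"
  using assms
proof (cases rule: orbit_cases)
  case (1 k)
  then show ?thesis using v_power_in_orbit[of k y] v_power_u_power by simp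
next
  case (2 k)
  then show ?thesis
    using u_power_in_orbit[of k y] unit_module.v_power_u_power[OF swap] by simp
qed

text \<open>By pigeonhole two powers of \<open>u\<close> agree on \<open>x\<close>, so \<open>u\<^sup>n\<close> fixes \<open>x\<close> for some \<open>n > 0\<close>. Hence
  \<open>v\<^sup>k x = v\<^sup>k u\<^sup>n\<^sup>k x\<close>, and as \<open>n k \<ge> k\<close> this is a nonnegative power of \<open>u\<close> applied to \<open>x\<close>.\<close>

lemma inverse_powers_subset_powers:
  assumes fin: "finite (UNIV :: 'b set)"
  shows "range (\<lambda>k. (v ^ k) *s x) \<subseteq> range (\<lambda>k. (u ^ k) *s x)"
proof -
  have "\<not> inj (\<lambda>k::nat. (u ^ k) *s x)"
    using fin finite_imageD finite_subset[OF subset_UNIV] infinite_UNIV_nat by blast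
  then obtain i j :: nat where "i < j" and eq: "(u ^ i) *s x = (u ^ j) *s x"
    unfolding inj_def by (metis nat_neq_iff)
  define n where "n = j - i"
  have n: "0 < n" "j = i + n" using \<open>i < j\<close> by (auto simp: n_def)
  have "x = (v ^ i) *s ((u ^ j) *s x)"
    using v_power_u_power[of i x] eq by simp
  also have "\<dots> = (v ^ i) *s ((u ^ i) *s ((u ^ n) *s x))"
    by (simp add: n(2) power_add)
  also have "\<dots> = (u ^ n) *s x" by (rule v_power_u_power)
  finally have fixed: "(u ^ n) *s x = x" by simp
  have period: "(u ^ (n * k)) *s x = x" for k
  proof (induction k)
    case (Suc k)
    have "(u ^ (n * Suc k)) *s x = (u ^ n) *s ((u ^ (n * k)) *s x)"
      by (simp add: power_add)
    with Suc fixed show ?case by simp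
  qed simp
  have "(v ^ k) *s x = (u ^ (n * k - k)) *s x" for k
  proof -
    have "n * k = k + (n * k - k)" using n(1) by simp
    then have "(v ^ k) *s x = (v ^ k) *s ((u ^ (k + (n * k - k))) *s x)"
      using period by metis
    also have "\<dots> = (v ^ k) *s ((u ^ k) *s ((u ^ (n * k - k)) *s x))"
      by (simp only: power_add scale_scale)
    finally show ?thesis by (simp only: v_power_u_power)
  qed
  then show ?thesis by blast
qed

lemma inverse_powers_eq_powers:
  assumes "finite (UNIV :: 'b set)"
  shows "range (\<lambda>k. (v ^ k) *s x) = range (\<lambda>k. (u ^ k) *s x)"
  using inverse_powers_subset_powers unit_module.inverse_powers_subset_powers[OF swap] assms
  by (simp add: subset_antisym)

end

section \<open>Racks from a module with two scalars\<close>

text \<open>The argument works for any commutative ring with elements that satisfy the defining relations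
  of \<open>\<int>[t, t\<^sup>-\<^sup>1, s] / \<langle>s\<^sup>2 - s (1 - t)\<rangle>\<close>.\<close>

locale st_module = Modules.module scale
  for scale :: "'a::comm_ring_1 \<Rightarrow> 'b::ab_group_add \<Rightarrow> 'b" (infixr "*s" 75) +
  fixes s t t' :: 'a
  assumes t_inverse: "t * t' = 1"
    and s_square: "s ^ 2 = s * (1 - t)"
begin

definition rop :: "'b \<Rightarrow> 'b \<Rightarrow> 'b" where
  "rop x y = s *s x + t *s y"

abbreviation "u \<equiv> s + t"
abbreviation "v \<equiv> (1 - s) * t'"

lemma s_s: "s * s = s - s * t"
  using s_square by (simp add: power2_eq_square right_diff_distrib)

sublocale unit_module scale u v
proof
  have "u * (1 - s) = t" by (simp add: algebra_simps s_s)
  then show "u * v = 1" using t_inverse by (simp flip: mult.assoc)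
qed

lemma s_u: "s * u = s"
  by (simp add: distrib_left s_s)

lemma s_u_power: "s * u ^ k = s"
proof (induction k)
  case (Suc k)
  have "s * u ^ Suc k = (s * u ^ k) * u" by (simp only: power_Suc2 mult.assoc)
  with Suc s_u show ?case by simp
qed simp

lemma s_v_power: "s * v ^ k = s"
proof -
  have "u ^ k * v ^ k = 1" using u_v by (simp flip: power_mult_distrib)
  then show ?thesis by (metis s_u_power mult.assoc mult_1_right)
qed

text \<open>The factor \<open>1 - s - t\<close> is annihilated by \<open>s\<close>, hence fixed by \<open>1 - s\<close>; this is what lets the
  correction term \<open>1 - (1 - s)\<^sup>k\<close> pass through the induction.\<close>

lemma u_power: "u ^ k = t ^ k + 1 - (1 - s) ^ k"
proof (induction k)
  case (Suc k)
  have absorb: "(1 - s) ^ j * (1 - s - t) = 1 - s - t" for j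
  proof (induction j)
    case (Suc j)
    have "(1 - s) * (1 - s - t) = 1 - s - t" by (simp add: algebra_simps s_s)
    then have "(1 - s) ^ Suc j * (1 - s - t) = (1 - s) ^ j * (1 - s - t)"
      by (simp add: power_Suc2 mult.assoc del: power_Suc)
    with Suc show ?case by simp
  qed simp
  \<comment> \<open>One step multiplies by \<open>u\<close>, and \<open>s u\<^sup>k = s\<close> makes this the affine recursion \<open>w \<mapsto> s + t w\<close>.\<close>
  have "u ^ Suc k = s + t * u ^ k"
    using s_u_power[of k] by (simp add: distrib_right)
  also have "\<dots> = t ^ Suc k + (s + t) - t * (1 - s) ^ k"
    by (simp add: Suc algebra_simps)
  also have "\<dots> = t ^ Suc k + 1 - (1 - s) ^ Suc k"
    using absorb[of k] by (simp add: algebra_simps)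
  finally show ?case .
qed simp

lemma s_scale_orbit:
  assumes "x \<in> orbit a"
  shows "s *s x = s *s a"
  using assms by (auto simp: orbit_def s_u_power s_v_power)

lemma rop_orbit:
  assumes "x \<in> orbit a" and "y \<in> orbit a"
  shows "rop x y = u *s y"
  using s_scale_orbit[OF assms(1)] s_scale_orbit[OF assms(2)]
  by (simp add: rop_def scale_left_distrib)

text \<open>With \<open>x \<triangleright> y = u y\<close> on the orbit, both sides of self-distributivity are \<open>u\<^sup>2 z\<close>, and
  \<open>x \<triangleright> z = y\<close> has the unique solution \<open>z = v y\<close>.\<close>

lemma is_rack_orbit: "is_rack (orbit a) rop"
proof -
  have "\<exists>!z. z \<in> orbit a \<and> rop x z = y" if x: "x \<in> orbit a" and y: "y \<in> orbit a" for x y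
  proof (rule ex1I[of _ "v *s y"])
    have "rop x (v *s y) = (u * v) *s y"
      by (simp add: rop_orbit[OF x orbit_step_inverse[OF y]])
    then show "v *s y \<in> orbit a \<and> rop x (v *s y) = y"
      using orbit_step_inverse[OF y] by (simp add: u_v)
  next
    fix z assume z: "z \<in> orbit a \<and> rop x z = y"
    then have "v *s y = (v * u) *s z"
      using rop_orbit[OF x, of z] by auto
    then show "z = v *s y" using u_v by (simp add: mult.commute)
  qed
  then show ?thesis by (auto simp: is_rack_def rop_orbit[of _ a] orbit_step simp del: scale_scale)
qed

text \<open>Forward along the orbit one applies the translation by \<open>a\<close>; backward, unique solvability of
  \<open>a \<triangleright> z = y\<close> supplies a solution inside \<open>S\<close>, which invertibility of \<open>t\<close> identifies as \<open>v y\<close>.\<close>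

lemma orbit_subset_rack:
  assumes S: "is_rack S rop" and a: "a \<in> S"
  shows "orbit a \<subseteq> S"
proof -
  have up: "rop a ((u ^ k) *s a) = (u ^ Suc k) *s a" for k
    using rop_orbit[OF orbit_refl u_power_in_orbit] by simp
  have down: "rop a ((v ^ Suc k) *s a) = (v ^ k) *s a" for k
  proof -
    have "rop a ((v ^ Suc k) *s a) = u *s ((v ^ Suc k) *s a)"
      by (rule rop_orbit[OF orbit_refl v_power_in_orbit])
    also have "\<dots> = (u * v * v ^ k) *s a" by (simp add: mult.assoc)
    finally show ?thesis by (simp add: u_v)
  qed
  have cancel: "y = z" if "rop a y = rop a z" for y z
  proof -
    have "(t' * t) *s y = (t' * t) *s z"
      using that by (simp add: rop_def flip: scale_scale)
    then show ?thesis using t_inverse by (simp add: mult.commute)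
  qed
  have "(u ^ k) *s a \<in> S" for k
  proof (induction k)
    case (Suc k)
    then have "rop a ((u ^ k) *s a) \<in> S" using S a unfolding is_rack_def by blast
    then show ?case by (simp only: up)
  qed (simp add: a)
  moreover have "(v ^ k) *s a \<in> S" for k
  proof (induction k)
    case (Suc k)
    then obtain z where "z \<in> S" "rop a z = (v ^ k) *s a"
      using S a unfolding is_rack_def by meson
    then show ?case using cancel down[of k] by metis
  qed (simp add: a)
  ultimately show ?thesis by (auto simp: orbit_def)
qed

lemma gen_subrack_eq_orbit: "gen_subrack UNIV rop a = orbit a"
proof
  show "gen_subrack UNIV rop a \<subseteq> orbit a"
    using is_rack_orbit orbit_refl by (auto simp: gen_subrack_def subrack_def)
  show "orbit a \<subseteq> gen_subrack UNIV rop a"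
    unfolding gen_subrack_def subrack_def using orbit_subset_rack by blast
qed

theorem gen_class_eq_orbit: "gen_class UNIV rop a = orbit a"
proof -
  have "orbit a = orbit b \<longleftrightarrow> b \<in> orbit a" for b
    using orbit_refl[of b] orbit_subset orbit_sym by blast
  then show ?thesis by (simp add: gen_class_def gen_subrack_eq_orbit)
qed

end

section \<open>The class of an element of an \<open>(s,t)\<close>-rack\<close>

theorem corollary3p3:
  fixes scale :: "st_ring \<Rightarrow> 'm \<Rightarrow> 'm::ab_group_add" and a :: 'm
  assumes "Modules.module scale"
  shows "gen_class UNIV (st_rack_op scale) a =
           {scale (t_st ^ k + 1 - (1 - s_st) ^ k) a | k :: nat. True} \<union>
           {scale ((1 - s_st) ^ k * t_inv_st ^ k) a | k :: nat. True} \<and>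
         (finite (UNIV :: 'm set) \<longrightarrow>
           gen_class UNIV (st_rack_op scale) a =
             {scale (t_st ^ k + 1 - (1 - s_st) ^ k) a | k :: nat. True} \<and>
           {scale (t_st ^ k + 1 - (1 - s_st) ^ k) a | k :: nat. True} =
             {scale ((1 - s_st) ^ k * t_inv_st ^ k) a | k :: nat. True})"
proof -
  interpret st_module scale s_st t_st t_inv_st
    using assms by (intro st_module.intro st_module_axioms.intro t_st_inverse s_st_square)
  have op: "st_rack_op scale = rop"
    by (intro ext) (simp add: st_rack_op_def rop_def)
  have pos: "{scale (t_st ^ k + 1 - (1 - s_st) ^ k) a | k :: nat. True} = range (\<lambda>k. scale (u ^ k) a)"
    by (auto simp: u_power)
  have neg: "{scale ((1 - s_st) ^ k * t_inv_st ^ k) a | k :: nat. True} = range (\<lambda>k. scale (v ^ k) a)"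
    by (auto simp: power_mult_distrib)
  show ?thesis
    unfolding pos neg op gen_class_eq_orbit
    using inverse_powers_eq_powers[of a] by (simp add: orbit_def)
qed

end
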